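(* Let $G$ be a connected graph of order $n\ge 2$. Then $$\partial_1^{L}(G)\le \frac{2W(G)}{n-1}+\sqrt{\frac{n-2}{n-1}\left(\|\mathcal{L}(G)\|_F^2-\frac{(2W(G))^2}{n-1}\right)}.$$ Equality holds if and only if $G=K_n$ or ($n\ge 3$ and) $G$ is a connected graph with exactly three distinct distance Laplacian eigenvalues, namely $\partial_1^{L}(G)$, $\frac{2W(G)-\partial_1^{L}(G)}{n-2}$ and $0$.
   Context: Graphs are finite, simple and undirected. For a connected graph $G$ with vertices $v_1,\ldots,v_n$, $d(u,v)$ is the length of a shortest path between $u$ and $v$; the distance matrix is $\mathcal{D}(G)=(d(v_i,v_j))_{i,j}$; the transmission of a vertex is $Tr(v)=\sum_{u\in V(G)}d(v,u)$; $Tr(G)=\mathrm{diag}[Tr(v_1),\ldots,Tr(v_n)]$. The Wiener index is $W(G)=\frac12\sum_{u,v\in V(G)}d(u,v)$ (sum over ordered pairs). The distance Laplacian matrix is $\mathcal{L}(G)=Tr(G)-\mathcal{D}(G)$; its eigenvalues, the distance Laplacian eigenvalues of $G$, are $\partial_1^{L}(G)\ge\cdots\ge\partial_n^{L}(G)$. $\|M\|_F=\sqrt{\sum_{i,j}|m_{i,j}|^2}$ is the Frobenius norm, and $K_n$ is the complete graph on $n$ vertices. *)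

theory Defs
  imports
    "Graph_Theory.Graph_Theory"
    "Jordan_Normal_Form.Spectral_Radius"
    "HOL-Computational_Algebra.Computational_Algebra"
begin

text \<open>
  A finite simple undirected graph is a symmetric digraph without loops and parallel arcs
  (locale \<open>graph\<close>): an edge is a pair of opposite arcs.  The matrices depend on an enumeration
  \<open>vs\<close> of the vertices.
\<close>

text \<open>For connected \<open>G\<close> and vertices \<open>u\<close>, \<open>v\<close> some path exists, so the minimum is attained.\<close>

definition graph_dist :: "('a, 'b) pre_digraph \<Rightarrow> 'a \<Rightarrow> 'a \<Rightarrow> nat" where
  "graph_dist G u v = (LEAST k. \<exists>p. pre_digraph.apath G u p v \<and> length p = k)"

definition transmission :: "('a, 'b) pre_digraph \<Rightarrow> 'a \<Rightarrow> real" where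
  "transmission G v = (\<Sum>u\<in>verts G. real (graph_dist G v u))"

definition wiener_index :: "('a, 'b) pre_digraph \<Rightarrow> real" where
  "wiener_index G = 1 / 2 * (\<Sum>u\<in>verts G. \<Sum>v\<in>verts G. real (graph_dist G u v))"

definition distance_matrix :: "('a, 'b) pre_digraph \<Rightarrow> 'a list \<Rightarrow> real mat" where
  "distance_matrix G vs =
     mat (length vs) (length vs) (\<lambda>(i, j). real (graph_dist G (vs ! i) (vs ! j)))"

definition transmission_matrix :: "('a, 'b) pre_digraph \<Rightarrow> 'a list \<Rightarrow> real mat" where
  "transmission_matrix G vs = mat_diag (length vs) (\<lambda>i. transmission G (vs ! i))"

definition distance_laplacian :: "('a, 'b) pre_digraph \<Rightarrow> 'a list \<Rightarrow> real mat" where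
  "distance_laplacian G vs = transmission_matrix G vs - distance_matrix G vs"

definition frobenius_norm :: "real mat \<Rightarrow> real" where
  "frobenius_norm A = sqrt (\<Sum>i<dim_row A. \<Sum>j<dim_col A. \<bar>A $$ (i, j)\<bar>\<^sup>2)"

text \<open>
  The eigenvalues of a real matrix, repeated according to algebraic multiplicity, in non-increasing
  order.  Only real roots of the characteristic polynomial are listed; for symmetric matrices
  these are all roots.
\<close>

definition eigenvalues_desc :: "real mat \<Rightarrow> real list" where
  "eigenvalues_desc A = rev (sorted_list_of_multiset (proots (char_poly A)))"

text \<open>The index \<open>i\<close> starts from 1, so that index 1 gives the largest eigenvalue.\<close>

definition dist_lap_eigenvalue :: "('a, 'b) pre_digraph \<Rightarrow> 'a list \<Rightarrow> nat \<Rightarrow> real" where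
  "dist_lap_eigenvalue G vs i = eigenvalues_desc (distance_laplacian G vs) ! (i - 1)"

end

theory Submission
  imports Defs
begin

text \<open>
  Write \<open>L\<close> for the distance Laplacian, \<open>S\<close> for its trace, which is \<open>2 W(G)\<close>, and \<open>F\<close> for its
  squared Frobenius norm.  As \<open>L\<close> is real and symmetric, its characteristic polynomial splits over
  the reals; the eigenvalues sum to \<open>S\<close> and their squares sum to \<open>F\<close>.  One of them is \<open>0\<close>, with the
  all-ones vector.  Removing this \<open>0\<close> and the largest eigenvalue \<open>l\<close> leaves \<open>n - 2\<close> numbers with
  sum \<open>S - l\<close> and sum of squares \<open>F - l\<^sup>2\<close>, so the Cauchy--Schwarz inequality gives
  \<open>(S - l)\<^sup>2 \<le> (n - 2) (F - l\<^sup>2)\<close>.  This is a quadratic inequality in \<open>l\<close>, and the bound is its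
  larger root.  Since \<open>l\<close> is at least the mean \<open>S / (n - 1)\<close>, it can only meet the larger root, so
  equality in the bound is equality in Cauchy--Schwarz: the \<open>n - 2\<close> remaining eigenvalues all
  equal some \<open>b\<close> (lemma \<open>max_le_mean_plus_deviation\<close>).

  It remains to see what a constant remainder means.  The kernel of \<open>L\<close> consists of the constant
  vectors, because \<open>2 x\<^sup>T L x\<close> is the sum of \<open>d(u,v) (x\<^sub>u - x\<^sub>v)\<^sup>2\<close> and all distances between
  different vertices are positive (lemma \<open>weighted_laplacian_kernel\<close>).  Hence \<open>0\<close> is a simple root
  of the characteristic polynomial (lemma \<open>zero_eigenvalue_simple\<close>) and \<open>b \<noteq> 0\<close>.

  If \<open>b = l\<close>, or if \<open>n = 2\<close>, then \<open>F = S\<^sup>2 / (n - 1)\<close>.  The difference of the two sides is the squared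
  Frobenius distance from \<open>L\<close> to the multiple of \<open>n I - J\<close>, the distance Laplacian of \<open>K\<^sub>n\<close>, that
  has trace \<open>S\<close>.  So this case says that all distances agree, which in a connected graph
  forces them to be \<open>1\<close> (lemma \<open>frobenius_eq_iff_complete\<close>).  If \<open>b \<noteq> l\<close>, there are exactly the three
  eigenvalues \<open>l\<close>, \<open>b\<close>, \<open>0\<close>, and the trace gives \<open>b = (S - l) / (n - 2)\<close>.  Conversely, if these are
  the only eigenvalues, then the \<open>n - 2\<close> remaining ones lie in \<open>{l, b}\<close>, where \<open>b \<le> l\<close>, and have
  mean \<open>b\<close>; so none of them equals \<open>l\<close> and the remainder is constant.
\<close>

section \<open>Trace and Frobenius norm in terms of eigenvalues\<close>

definition mat_trace :: "'a::comm_monoid_add mat \<Rightarrow> 'a" where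
  "mat_trace A = (\<Sum>i<dim_row A. A $$ (i, i))"

lemma mat_mult_index_sum:
  assumes "A \<in> carrier_mat n m" "B \<in> carrier_mat m k" "i < n" "j < k"
  shows "(A * B) $$ (i, j) = (\<Sum>l<m. A $$ (i, l) * B $$ (l, j))"
  using assms by (auto simp: scalar_prod_def atLeast0LessThan intro!: sum.cong)

lemma mat_vec_mult_index_sum:
  assumes "A \<in> carrier_mat n m" "x \<in> carrier_vec m" "i < n"
  shows "(A *\<^sub>v x) $ i = (\<Sum>j<m. A $$ (i, j) * x $ j)"
  using assms by (auto simp: scalar_prod_def atLeast0LessThan intro!: sum.cong)

lemma mat_trace_mult_commute:
  fixes A B :: "'a::comm_semiring_0 mat"
  assumes "A \<in> carrier_mat n m" "B \<in> carrier_mat m n"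
  shows "mat_trace (A * B) = mat_trace (B * A)"
proof -
  have "mat_trace (A * B) = (\<Sum>i<n. \<Sum>l<m. A $$ (i, l) * B $$ (l, i))"
    using assms unfolding mat_trace_def
    by (auto intro!: sum.cong simp: mat_mult_index_sum[OF assms] simp del: index_mult_mat(1))
  also have "\<dots> = (\<Sum>l<m. \<Sum>i<n. B $$ (l, i) * A $$ (i, l))"
    by (subst sum.swap) (simp add: mult.commute)
  also have "\<dots> = mat_trace (B * A)"
    using assms unfolding mat_trace_def
    by (auto intro!: sum.cong simp: mat_mult_index_sum[OF assms(2,1)] simp del: index_mult_mat(1))
  finally show ?thesis .
qed

lemma mat_trace_similar:
  fixes A :: "'a::comm_ring_1 mat"
  assumes "similar_mat_wit A B P Q"
  shows "mat_trace A = mat_trace B"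
proof -
  define n where "n = dim_row A"
  note w = similar_mat_witD[OF n_def assms]
  have "mat_trace A = mat_trace (P * (B * Q))"
    using w by (simp add: assoc_mult_mat[of _ n n _ n _ n])
  also have "\<dots> = mat_trace (B * Q * P)"
    using w by (intro mat_trace_mult_commute[of _ n n]) auto
  also have "B * Q * P = B"
    using w by (simp add: assoc_mult_mat[of _ n n _ n _ n])
  finally show ?thesis .
qed

lemma schur_triangularization:
  fixes A :: "real mat"
  assumes A: "A \<in> carrier_mat n n" and cp: "char_poly A = (\<Prod>e\<leftarrow>es. [:- e, 1:])"
  obtains B P Q where "similar_mat_wit A B P Q" "upper_triangular B" "diag_mat B = es"
proof -
  obtain B P Q where "schur_decomposition A es = (B, P, Q)" by (metis prod_cases3)
  with schur_decomposition[OF A cp] that show ?thesis by blast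
qed

text \<open>
  Trace is invariant under similarity, so both sums can be read off a Schur triangular form \<open>B\<close>: the
  diagonal of \<open>B\<close> lists the eigenvalues, and that of \<open>B * B\<close> their squares.
\<close>

lemma sum_eigenvalues:
  fixes A :: "real mat"
  assumes A: "A \<in> carrier_mat n n" and cp: "char_poly A = (\<Prod>e\<leftarrow>es. [:- e, 1:])"
  shows "sum_list es = mat_trace A"
    and "sum_list (map (\<lambda>e. e\<^sup>2) es) = mat_trace (A * A)"
proof -
  obtain B P Q where w: "similar_mat_wit A B P Q" and u: "upper_triangular B" and d: "diag_mat B = es"
    using schur_triangularization[OF assms] .
  have B: "B \<in> carrier_mat n n" using similar_mat_witD2[OF A w] by simp
  have es: "es = map (\<lambda>i. B $$ (i, i)) [0..<n]" using d B by (auto simp: diag_mat_def)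
  show "sum_list es = mat_trace A"
    unfolding mat_trace_similar[OF w] using B
    by (simp add: es mat_trace_def interv_sum_list_conv_sum_set_nat atLeast0LessThan)
  have "similar_mat_wit (A ^\<^sub>m 2) (B ^\<^sub>m 2) P Q" by (rule similar_mat_wit_pow[OF w])
  hence "mat_trace (A * A) = mat_trace (B * B)"
    using A B mat_trace_similar by (fastforce simp: numeral_2_eq_2)
  also have "\<dots> = (\<Sum>i<n. (B $$ (i, i))\<^sup>2)"
  proof -
    have "(B * B) $$ (i, i) = (B $$ (i, i))\<^sup>2" if i: "i < n" for i
    proof -
      have "(B * B) $$ (i, i) = (\<Sum>l<n. B $$ (i, l) * B $$ (l, i))"
        using mat_mult_index_sum[OF B B i i] .
      also have "\<dots> = (\<Sum>l\<in>{i}. B $$ (i, l) * B $$ (l, i))"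
        using i B u by (intro sum.mono_neutral_right) (auto simp: upper_triangular_def, metis nat_neq_iff)
      finally show ?thesis by (simp add: power2_eq_square)
    qed
    thus ?thesis using B by (auto simp: mat_trace_def simp del: index_mult_mat(1))
  qed
  finally show "sum_list (map (\<lambda>e. e\<^sup>2) es) = mat_trace (A * A)"
    by (simp add: es comp_def interv_sum_list_conv_sum_set_nat atLeast0LessThan)
qed

lemma frobenius_norm_sum:
  assumes "A \<in> carrier_mat n n"
  shows "(frobenius_norm A)\<^sup>2 = (\<Sum>i<n. \<Sum>j<n. (A $$ (i, j))\<^sup>2)"
  using assms unfolding frobenius_norm_def by (simp add: sum_nonneg)

lemma frobenius_norm_symmetric:
  assumes A: "A \<in> carrier_mat n n" and sym: "\<And>i j. i < n \<Longrightarrow> j < n \<Longrightarrow> A $$ (i, j) = A $$ (j, i)"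
  shows "(frobenius_norm A)\<^sup>2 = mat_trace (A * A)"
proof -
  have "(frobenius_norm A)\<^sup>2 = (\<Sum>i<n. \<Sum>j<n. (A $$ (i, j))\<^sup>2)"
    by (rule frobenius_norm_sum[OF A])
  also have "\<dots> = (\<Sum>i<n. \<Sum>j<n. A $$ (i, j) * A $$ (j, i))"
    by (intro sum.cong) (auto simp: power2_eq_square sym)
  also have "\<dots> = mat_trace (A * A)"
    using A unfolding mat_trace_def
    by (auto intro!: sum.cong simp: mat_mult_index_sum[OF A A] simp del: index_mult_mat(1))
  finally show ?thesis .
qed

section \<open>Real symmetric matrices\<close>

text \<open>
  For an eigenvector \<open>v\<close> the number \<open>v\<^sup>* A v\<close> equals \<open>e\<close> times the positive real \<open>v\<^sup>* v\<close>, and it is its own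
  conjugate because \<open>A\<close> is real and symmetric.
\<close>

lemma complex_eigenvalue_of_real_symmetric:
  fixes A :: "real mat"
  assumes A: "A \<in> carrier_mat n n" and sym: "\<And>i j. i < n \<Longrightarrow> j < n \<Longrightarrow> A $$ (i, j) = A $$ (j, i)"
    and ev: "eigenvalue (map_mat complex_of_real A) e"
  shows "e \<in> \<real>"
proof -
  let ?A = "map_mat complex_of_real A"
  have cA: "?A \<in> carrier_mat n n" using A by simp
  obtain v where v: "v \<in> carrier_vec n" "v \<noteq> 0\<^sub>v n" "?A *\<^sub>v v = e \<cdot>\<^sub>v v"
    using ev A unfolding eigenvalue_def eigenvector_def by auto
  define N where "N = (\<Sum>i<n. (cmod (v $ i))\<^sup>2)"
  define S where "S = (\<Sum>i<n. cnj (v $ i) * (?A *\<^sub>v v) $ i)"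
  have "S = (\<Sum>i<n. e * complex_of_real ((cmod (v $ i))\<^sup>2))"
    unfolding S_def using v(1,3)
    by (intro sum.cong refl) (simp add: complex_norm_square del: of_real_power)
  hence 1: "S = e * complex_of_real N" by (simp add: N_def sum_distrib_left)
  have S2: "S = (\<Sum>i<n. \<Sum>j<n. cnj (v $ i) * complex_of_real (A $$ (i, j)) * v $ j)"
    unfolding S_def using A by (auto intro!: sum.cong
        simp: mat_vec_mult_index_sum[OF cA v(1)] sum_distrib_left mult.assoc simp del: index_mult_mat_vec)
  have "cnj S = (\<Sum>i<n. \<Sum>j<n. v $ i * complex_of_real (A $$ (i, j)) * cnj (v $ j))"
    unfolding S2 by simp
  also have "\<dots> = S" unfolding S2
    by (subst sum.swap, intro sum.cong) (auto simp: sym)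
  finally have "cnj e * complex_of_real N = e * complex_of_real N" unfolding 1 by simp
  moreover have "N \<noteq> 0"
  proof
    assume "N = 0"
    hence "v $ i = 0" if "i < n" for i
      using that unfolding N_def by (subst (asm) sum_nonneg_eq_0_iff) auto
    with v show False by auto
  qed
  ultimately show ?thesis by (simp add: Reals_cnj_iff)
qed

text \<open>
  The characteristic polynomial splits over the complex numbers with real roots only, and the
  embedding of real into complex polynomials is injective.
\<close>

lemma char_poly_splits_real_symmetric:
  fixes A :: "real mat"
  assumes A: "A \<in> carrier_mat n n" and sym: "\<And>i j. i < n \<Longrightarrow> j < n \<Longrightarrow> A $$ (i, j) = A $$ (j, i)"
  obtains es where "char_poly A = (\<Prod>e\<leftarrow>es. [:- e, 1:])" "length es = n"
proof -
  let ?A = "map_mat complex_of_real A"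
  have cA: "?A \<in> carrier_mat n n" using A by simp
  obtain as where as: "char_poly ?A = (\<Prod>a\<leftarrow>as. [:- a, 1:])" "length as = n"
    using char_poly_factorized[OF cA] by auto
  have real: "a \<in> \<real>" if "a \<in> set as" for a
  proof -
    have "poly (char_poly ?A) a = 0"
      unfolding as(1) poly_prod_list using that by (auto simp: prod_list_zero_iff)
    thus ?thesis
      using complex_eigenvalue_of_real_symmetric[OF A sym] eigenvalue_root_char_poly[OF cA] by blast
  qed
  interpret h: map_poly_inj_comm_ring_hom complex_of_real
    by unfold_locales auto
  have "map_poly complex_of_real (\<Prod>e\<leftarrow>map Re as. [:- e, 1:]) = (\<Prod>a\<leftarrow>as. [:- a, 1:])"
    using real by (induction as)
      (auto simp: h.hom_mult of_real_Re simp del: mult_pCons_left mult_pCons_right)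
  also have "\<dots> = map_poly complex_of_real (char_poly A)"
    using of_real_hom.char_poly_hom[OF A] as(1) by metis
  finally have "char_poly A = (\<Prod>e\<leftarrow>map Re as. [:- e, 1:])" by simp
  with as(2) that show ?thesis by (metis length_map)
qed

text \<open>
  The squared norm of \<open>A x\<close> is \<open>x\<^sup>T A A x\<close>.
\<close>

lemma kernel_square_symmetric:
  fixes A :: "real mat"
  assumes A: "A \<in> carrier_mat n n" and sym: "\<And>i j. i < n \<Longrightarrow> j < n \<Longrightarrow> A $$ (i, j) = A $$ (j, i)"
    and x: "x \<in> carrier_vec n" and AAx: "A *\<^sub>v (A *\<^sub>v x) = 0\<^sub>v n"
  shows "A *\<^sub>v x = 0\<^sub>v n"
proof -
  let ?y = "A *\<^sub>v x"
  have y: "?y \<in> carrier_vec n" using A x by simp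
  have "?y \<bullet> ?y = (\<Sum>i<n. \<Sum>j<n. A $$ (i, j) * x $ j * ?y $ i)"
    using A y mat_vec_mult_index_sum[OF A x]
    by (simp add: scalar_prod_def atLeast0LessThan sum_distrib_right del: index_mult_mat_vec)
  also have "\<dots> = (\<Sum>j<n. \<Sum>i<n. x $ j * (A $$ (j, i) * ?y $ i))"
    by (subst sum.swap, intro sum.cong) (auto simp: sym)
  also have "\<dots> = (\<Sum>j<n. x $ j * (A *\<^sub>v ?y) $ j)"
    by (intro sum.cong) (auto simp: mat_vec_mult_index_sum[OF A y] sum_distrib_left
        simp del: index_mult_mat_vec)
  finally have "?y \<bullet> ?y = 0" unfolding AAx by simp
  hence "(\<Sum>i<n. (?y $ i)\<^sup>2) = 0" using y A
    by (simp add: scalar_prod_def power2_eq_square atLeast0LessThan)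
  hence "\<forall>i<n. ?y $ i = 0" by (subst (asm) sum_nonneg_eq_0_iff) auto
  thus ?thesis using y A by (intro eq_vecI) auto
qed


text \<open>
  If \<open>0\<close> were a multiple root, one could order the eigenvalues in a Schur form so that two zeros
  come first.  The first two vectors of the Schur basis are then independent vectors killed by \<open>A * A\<close>, hence by
  \<open>A\<close> as \<open>A\<close> is symmetric, and the kernel would not be a line.
\<close>

lemma zero_eigenvalue_simple:
  fixes A :: "real mat"
  assumes A: "A \<in> carrier_mat n n" and sym: "\<And>i j. i < n \<Longrightarrow> j < n \<Longrightarrow> A $$ (i, j) = A $$ (j, i)"
    and cp: "char_poly A = (\<Prod>e\<leftarrow>es. [:- e, 1:])"
    and ker: "\<And>x. x \<in> carrier_vec n \<Longrightarrow> A *\<^sub>v x = 0\<^sub>v n \<Longrightarrow> \<exists>c. x = c \<cdot>\<^sub>v w"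
    and w: "w \<in> carrier_vec n"
  shows "count (mset es) 0 \<le> 1"
proof (rule ccontr)
  assume "\<not> count (mset es) 0 \<le> 1"
  hence "replicate_mset 2 0 \<subseteq># mset es" by (subst count_le_replicate_mset_subset_eq[symmetric]) simp
  then obtain M where M: "mset es = replicate_mset 2 0 + M"
    unfolding subset_mset.le_iff_add by blast
  obtain rest where "mset rest = M" using ex_mset by blast
  with M have rest: "mset es = mset (0 # 0 # rest)" by (simp add: numeral_2_eq_2)
  have "(\<Prod>e\<leftarrow>es. [:- e, 1:]) = (\<Prod>e\<leftarrow>0 # 0 # rest. [:- e, 1:])"
    by (simp only: prod_mset_prod_list[symmetric] mset_map rest)
  with cp have "char_poly A = (\<Prod>e\<leftarrow>0 # 0 # rest. [:- e, 1:])" by simp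
  then obtain B P Q where wit: "similar_mat_wit A B P Q" and u: "upper_triangular B"
    and d: "diag_mat B = 0 # 0 # rest"
    using schur_triangularization[OF A] by blast
  note W = similar_mat_witD2[OF A wit]
  have B: "B \<in> carrier_mat n n" and P: "P \<in> carrier_mat n n" and Q: "Q \<in> carrier_mat n n"
    and QP: "Q * P = 1\<^sub>m n" and APBQ: "A = P * B * Q" using W by auto
  have n: "2 \<le> n" using arg_cong[OF d, of length] B by (simp add: diag_mat_def)
  have B0: "B $$ (0, 0) = 0" and B1: "B $$ (1, 1) = 0"
    using arg_cong[OF d, of "\<lambda>xs. xs ! 0"] arg_cong[OF d, of "\<lambda>xs. xs ! 1"] B n
    by (auto simp: diag_mat_def)
  let ?e = "\<lambda>i. unit_vec n i :: real vec"
  define p q where "p = P *\<^sub>v ?e 0" and "q = P *\<^sub>v ?e 1"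
  have p: "p \<in> carrier_vec n" and q: "q \<in> carrier_vec n" unfolding p_def q_def using P by auto
  have QPx: "Q *\<^sub>v (P *\<^sub>v x) = x" if "x \<in> carrier_vec n" for x
    using that P Q QP by (metis assoc_mult_mat_vec one_mult_mat_vec)
  have APx: "A *\<^sub>v (P *\<^sub>v x) = P *\<^sub>v (B *\<^sub>v x)" if x: "x \<in> carrier_vec n" for x
  proof -
    have "A *\<^sub>v (P *\<^sub>v x) = (P * B) *\<^sub>v (Q *\<^sub>v (P *\<^sub>v x))"
      unfolding APBQ using B P Q x by (intro assoc_mult_mat_vec[of _ n n _ n]) auto
    also have "\<dots> = P *\<^sub>v (B *\<^sub>v x)"
      unfolding QPx[OF x] using B P x by (intro assoc_mult_mat_vec[of _ n n _ n]) auto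
    finally show ?thesis .
  qed
  have Bcol: "B *\<^sub>v ?e j = col B j" if "j < n" for j
    using B that by (intro eq_vecI) auto
  have "B *\<^sub>v ?e 0 = 0\<^sub>v n"
  proof -
    have "col B 0 $ i = 0" if "i < n" for i
      using that u B B0 unfolding upper_triangular_def by (cases "i = 0") auto
    thus ?thesis using Bcol[of 0] B n by (intro eq_vecI) auto
  qed
  hence Ap: "A *\<^sub>v p = 0\<^sub>v n" unfolding p_def using APx[of "?e 0"] P by auto
  have "B *\<^sub>v ?e 1 = B $$ (0, 1) \<cdot>\<^sub>v ?e 0"
  proof -
    have entry: "col B 1 $ i = (B $$ (0, 1) \<cdot>\<^sub>v ?e 0) $ i" if "i < n" for i
      using that u B B1 n unfolding upper_triangular_def
      by (cases "i = 0"; cases "i = 1") auto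
    have "B *\<^sub>v ?e 1 = col B 1" by (rule Bcol) (use n in simp)
    also have "\<dots> = B $$ (0, 1) \<cdot>\<^sub>v ?e 0"
      by (rule eq_vecI, rule entry) (use B in simp_all)
    finally show ?thesis .
  qed
  hence "A *\<^sub>v q = B $$ (0, 1) \<cdot>\<^sub>v p"
    unfolding q_def p_def using APx[of "?e 1"] mult_mat_vec[OF P, of "?e 0"] by auto
  hence "A *\<^sub>v (A *\<^sub>v q) = 0\<^sub>v n" using mult_mat_vec[OF A p] Ap by auto
  hence "A *\<^sub>v q = 0\<^sub>v n" using kernel_square_symmetric[OF A sym q] by simp
  then obtain c d where c: "p = c \<cdot>\<^sub>v w" and d: "q = d \<cdot>\<^sub>v w" using ker[OF p Ap] ker[OF q] by blast
  \<comment> \<open>\<open>Q\<close> undoes \<open>P\<close>, so the dependence of \<open>p\<close> and \<open>q\<close> carries over to the unit vectors.\<close>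
  have "?e 0 = c \<cdot>\<^sub>v (Q *\<^sub>v w)" "?e 1 = d \<cdot>\<^sub>v (Q *\<^sub>v w)"
    using QPx[of "?e 0"] QPx[of "?e 1"] c d mult_mat_vec[OF Q w] unfolding p_def q_def by auto
  hence "?e 0 $ i = c * (Q *\<^sub>v w) $ i" "?e 1 $ i = d * (Q *\<^sub>v w) $ i" if "i < n" for i
    using that Q by auto
  from this[of 0] this[of 1] n show False by auto
qed

lemma spectrum_and_max_eigenvalue:
  fixes A :: "real mat"
  assumes A: "A \<in> carrier_mat n n" and cp: "char_poly A = (\<Prod>e\<leftarrow>es. [:- e, 1:])"
  shows "spectrum A = set es" and "es \<noteq> [] \<Longrightarrow> eigenvalues_desc A ! 0 = Max (set es)"
proof -
  show "spectrum A = set es"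
    unfolding spectrum_root_char_poly[OF A] cp poly_prod_list
    by (auto simp: prod_list_zero_iff)
  have "proots (char_poly A) = mset es"
    unfolding cp
  proof (induction es)
    case (Cons e es)
    have "(\<Prod>e\<leftarrow>es. [:- e, 1:]) \<noteq> 0" by (auto simp: prod_list_zero_iff)
    thus ?case using Cons by (simp add: proots_mult del: mult_pCons_left)
  qed simp
  hence "eigenvalues_desc A = rev (sort es)"
    by (simp add: eigenvalues_desc_def)
  moreover assume "es \<noteq> []"
  moreover have "Max (set es) = sort es ! (length es - 1)"
  proof (rule Max_eqI)
    fix x assume "x \<in> set es"
    hence "x \<in> set (sort es)" by simp
    then obtain i where "i < length es" "x = sort es ! i" unfolding in_set_conv_nth by auto
    thus "x \<le> sort es ! (length es - 1)" by (simp add: sorted_nth_mono)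
  next
    have "sort es ! (length es - 1) \<in> set (sort es)" using \<open>es \<noteq> []\<close> by (intro nth_mem) simp
    thus "sort es ! (length es - 1) \<in> set es" by simp
  qed simp
  ultimately show "eigenvalues_desc A ! 0 = Max (set es)"
    by (simp add: rev_nth)
qed

section \<open>Bounding the largest eigenvalue\<close>

lemma sum_list_squared_deviation:
  fixes m :: real
  assumes "real (length xs) * m = sum_list xs"
  shows "(\<Sum>x\<leftarrow>xs. (x - m)\<^sup>2) = (\<Sum>x\<leftarrow>xs. x\<^sup>2) - real (length xs) * m\<^sup>2"
proof -
  have "(\<Sum>x\<leftarrow>xs. (x - m)\<^sup>2) = (\<Sum>x\<leftarrow>xs. x\<^sup>2) - 2 * m * sum_list xs + real (length xs) * m\<^sup>2"
    by (induction xs) (auto simp: power2_eq_square algebra_simps)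
  thus ?thesis unfolding assms[symmetric] by (simp add: power2_eq_square)
qed

text \<open>
  With \<open>V\<close> the sum of squared deviations of \<open>xs\<close> from their mean \<open>m\<close>, the radicand is
  \<open>(l - S / (k + 1))\<^sup>2 + k / (k + 1) * V\<close>.  The bound drops \<open>V \<ge> 0\<close>, so it is attained iff \<open>xs\<close> is constant.
  The maximality of \<open>l\<close> makes \<open>l - S / (k + 1)\<close> nonnegative, so that the square root returns it
  without a change of sign.
\<close>

lemma max_le_mean_plus_deviation:
  fixes l :: real and xs :: "real list"
  defines "k \<equiv> real (length xs)"
  defines "S \<equiv> l + sum_list xs" and "F \<equiv> l\<^sup>2 + (\<Sum>x\<leftarrow>xs. x\<^sup>2)"
  assumes max: "\<And>x. x \<in> set xs \<Longrightarrow> x \<le> l"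
  shows "l \<le> S / (k + 1) + sqrt (k / (k + 1) * (F - S\<^sup>2 / (k + 1)))"
    and "l = S / (k + 1) + sqrt (k / (k + 1) * (F - S\<^sup>2 / (k + 1))) \<longleftrightarrow> (\<exists>b. set xs \<subseteq> {b})"
    and "S \<le> (k + 1) * l"
proof -
  let ?X = "k / (k + 1) * (F - S\<^sup>2 / (k + 1))"
  define m where "m = sum_list xs / k"
  define V where "V = (\<Sum>x\<leftarrow>xs. (x - m)\<^sup>2)"
  have k: "0 \<le> k" by (simp add: k_def)
  have km: "k * m = sum_list xs" by (cases "xs = []") (auto simp: m_def k_def)
  have V: "V = (\<Sum>x\<leftarrow>xs. x\<^sup>2) - k * m\<^sup>2"
    using sum_list_squared_deviation[of xs m] km by (simp add: V_def k_def)
  have V0: "0 \<le> V" unfolding V_def by (intro sum_list_nonneg) auto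
  have X: "?X = (l - S / (k + 1))\<^sup>2 + k / (k + 1) * V"
  proof -
    have S: "S = l + k * m" and F: "F = l\<^sup>2 + V + k * m\<^sup>2" by (simp_all add: S_def F_def km V)
    have t: "k + 1 \<noteq> 0" using k by simp
    have 1: "l - S / (k + 1) = k * (l - m) / (k + 1)"
      unfolding S using t by (simp add: field_simps)
    have 2: "F - S\<^sup>2 / (k + 1) = (k * (l - m)\<^sup>2 + (k + 1) * V) / (k + 1)"
      unfolding S F using t by (simp add: field_simps) (simp add: power2_eq_square algebra_simps)
    have "k / t * ((k * (l - m)\<^sup>2 + t * V) / t) = (k * (l - m) / t)\<^sup>2 + k / t * V"
      if "t \<noteq> 0" for t using that by (simp add: field_simps power2_eq_square)
    from this[OF t] show ?thesis unfolding 1 2 .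
  qed
  have "(\<Sum>x\<leftarrow>xs. x) \<le> (\<Sum>x\<leftarrow>xs. l)" using max by (intro sum_list_mono)
  hence "sum_list xs \<le> k * l" by (simp add: k_def sum_list_triv)
  thus Sl: "S \<le> (k + 1) * l" by (simp add: S_def algebra_simps)
  hence nonneg: "0 \<le> l - S / (k + 1)" using k by (simp add: field_simps)
  have X2: "(l - S / (k + 1))\<^sup>2 \<le> ?X" unfolding X using k V0 by simp
  show "l \<le> S / (k + 1) + sqrt ?X" using real_le_rsqrt[OF X2] by simp
  have "l = S / (k + 1) + sqrt ?X \<longleftrightarrow> sqrt ((l - S / (k + 1))\<^sup>2) = sqrt ?X"
    using nonneg by (auto simp: algebra_simps)
  also have "\<dots> \<longleftrightarrow> k = 0 \<or> V = 0" unfolding real_sqrt_eq_iff X using k by auto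
  also have "\<dots> \<longleftrightarrow> (\<exists>b. set xs \<subseteq> {b})"
  proof
    assume "k = 0 \<or> V = 0"
    thus "\<exists>b. set xs \<subseteq> {b}"
    proof
      assume "V = 0"
      hence "\<forall>x\<in>set xs. x = m" unfolding V_def by (subst (asm) sum_list_nonneg_eq_0_iff) auto
      thus ?thesis by blast
    qed (simp add: k_def)
  next
    assume "\<exists>b. set xs \<subseteq> {b}"
    then obtain b where b: "set xs \<subseteq> {b}" by blast
    hence "sum_list xs = k * b"
      unfolding k_def by (induction xs) (auto simp: algebra_simps)
    hence "k = 0 \<or> m = b" using km by auto
    moreover have "V = 0" if "m = b"
      unfolding V_def using b that by (induction xs) auto
    ultimately show "k = 0 \<or> V = 0" by blast
  qed
  finally show "l = S / (k + 1) + sqrt ?X \<longleftrightarrow> (\<exists>b. set xs \<subseteq> {b})" .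
qed

text \<open>
  A positive trace makes the largest eigenvalue positive.  It is therefore not the eigenvalue \<open>0\<close>,
  and the two can be removed from the list independently.
\<close>

lemma spectrum_split_max_and_zero:
  fixes A :: "real mat"
  assumes A: "A \<in> carrier_mat n n" and sym: "\<And>i j. i < n \<Longrightarrow> j < n \<Longrightarrow> A $$ (i, j) = A $$ (j, i)"
    and ker: "\<And>x. x \<in> carrier_vec n \<Longrightarrow> A *\<^sub>v x = 0\<^sub>v n \<Longrightarrow> \<exists>c. x = c \<cdot>\<^sub>v w"
    and w: "w \<in> carrier_vec n" "w \<noteq> 0\<^sub>v n" "A *\<^sub>v w = 0\<^sub>v n"
    and pos: "0 < mat_trace A"
  obtains xs where "n = length xs + 2" "0 \<notin> set xs" "eigenvalues_desc A ! 0 \<noteq> 0"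
    "\<And>x. x \<in> set xs \<Longrightarrow> x \<le> eigenvalues_desc A ! 0"
    "spectrum A = insert (eigenvalues_desc A ! 0) (insert 0 (set xs))"
    "mat_trace A = eigenvalues_desc A ! 0 + sum_list xs"
    "(frobenius_norm A)\<^sup>2 = (eigenvalues_desc A ! 0)\<^sup>2 + (\<Sum>x\<leftarrow>xs. x\<^sup>2)"
proof -
  obtain es where cp: "char_poly A = (\<Prod>e\<leftarrow>es. [:- e, 1:])" and len: "length es = n"
    using char_poly_splits_real_symmetric[OF A sym] by blast
  define l where "l = eigenvalues_desc A ! 0"
  note tr = sum_eigenvalues[OF A cp]
  have ne: "es \<noteq> []" using tr(1) pos by auto
  have l: "l = Max (set es)" using spectrum_and_max_eigenvalue(2)[OF A cp ne] by (simp add: l_def)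
  have le: "e \<le> l" if "e \<in> set es" for e unfolding l using that by simp
  have l_in: "l \<in> set es" unfolding l using ne by (intro Max_in) auto
  have "eigenvalue A 0"
    unfolding eigenvalue_def eigenvector_def using w A by (intro exI[of _ w]) auto
  hence zero: "0 \<in> set es"
    using spectrum_and_max_eigenvalue(1)[OF A cp] by (auto simp: spectrum_def)
  have "l \<noteq> 0"
  proof
    assume "l = 0"
    hence "sum_list es \<le> 0" using le by (intro sum_list_nonpos) auto
    with tr(1) pos show False by simp
  qed
  define xs where "xs = remove1 0 (remove1 l es)"
  have m: "mset es = {#l, 0#} + mset xs"
  proof -
    have remove: "mset ys = add_mset y (mset (remove1 y ys))" if "y \<in> set ys" for y ys
      using that by simp
    have "0 \<in> set (remove1 l es)" using zero \<open>l \<noteq> 0\<close> by simp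
    from remove[OF l_in] remove[OF this] show ?thesis by (simp add: xs_def del: mset_remove1)
  qed
  show ?thesis
  proof (rule that[of xs, folded l_def])
    show "n = length xs + 2" using arg_cong[OF m, of size] len by simp
    have "count (mset es) 0 \<le> 1" by (rule zero_eigenvalue_simple[OF A sym cp ker w(1)])
    thus "0 \<notin> set xs" unfolding m using \<open>l \<noteq> 0\<close> by (auto simp flip: count_greater_zero_iff)
    have set: "set es = insert l (insert 0 (set xs))" using arg_cong[OF m, of set_mset] by simp
    thus "spectrum A = insert l (insert 0 (set xs))"
      using spectrum_and_max_eigenvalue(1)[OF A cp] by simp
    show "x \<le> l" if "x \<in> set xs" for x using le[of x] that set by simp
    show "mat_trace A = l + sum_list xs"
      using tr(1) arg_cong[OF m, of sum_mset] by (simp add: sum_mset_sum_list)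
    have "(\<Sum>e\<leftarrow>es. e\<^sup>2) = l\<^sup>2 + (\<Sum>x\<leftarrow>xs. x\<^sup>2)"
      using arg_cong[OF m, of "\<lambda>M. \<Sum>e\<in>#M. e\<^sup>2"]
      by (simp add: sum_mset_sum_list flip: mset_map)
    thus "(frobenius_norm A)\<^sup>2 = l\<^sup>2 + (\<Sum>x\<leftarrow>xs. x\<^sup>2)"
      using tr(2) frobenius_norm_symmetric[OF A sym] by simp
  qed (rule \<open>l \<noteq> 0\<close>)
qed

text \<open>
  The case \<open>F = S\<^sup>2 / (n - 1)\<close>, in which the radicand vanishes, is the one where all nonzero eigenvalues
  coincide.  For the distance Laplacian it characterises complete graphs.
\<close>

lemma largest_eigenvalue_bound:
  fixes A :: "real mat"
  defines "l \<equiv> eigenvalues_desc A ! 0" and "S \<equiv> mat_trace A" and "F \<equiv> (frobenius_norm A)\<^sup>2"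
  assumes A: "A \<in> carrier_mat n n" and sym: "\<And>i j. i < n \<Longrightarrow> j < n \<Longrightarrow> A $$ (i, j) = A $$ (j, i)"
    and ker: "\<And>x. x \<in> carrier_vec n \<Longrightarrow> A *\<^sub>v x = 0\<^sub>v n \<Longrightarrow> \<exists>c. x = c \<cdot>\<^sub>v w"
    and w: "w \<in> carrier_vec n" "w \<noteq> 0\<^sub>v n" "A *\<^sub>v w = 0\<^sub>v n"
    and pos: "0 < S"
  shows "l \<le> S / (real n - 1) + sqrt ((real n - 2) / (real n - 1) * (F - S\<^sup>2 / (real n - 1)))"
    and "l = S / (real n - 1) + sqrt ((real n - 2) / (real n - 1) * (F - S\<^sup>2 / (real n - 1)))
      \<longleftrightarrow> F = S\<^sup>2 / (real n - 1)
        \<or> (3 \<le> n \<and> card (spectrum A) = 3 \<and> spectrum A = {l, (S - l) / (real n - 2), 0})"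
proof -
  obtain xs where n: "n = length xs + 2" and xs0: "0 \<notin> set xs" and l0: "l \<noteq> 0"
    and max: "\<And>x. x \<in> set xs \<Longrightarrow> x \<le> l"
    and spec: "spectrum A = insert l (insert 0 (set xs))"
    and S: "S = l + sum_list xs" and F: "F = l\<^sup>2 + (\<Sum>x\<leftarrow>xs. x\<^sup>2)"
    by (rule spectrum_split_max_and_zero
      [OF A sym ker w pos[unfolded S_def], folded l_def S_def F_def]) (assumption | rule that)+
  define k where "k = real (length xs)"
  have n1: "real n - 1 = k + 1" and n2: "real n - 2 = k" by (auto simp: n k_def)
  have k: "0 \<le> k" by (simp add: k_def)
  note bound = max_le_mean_plus_deviation[of xs l, OF max, folded S F k_def]
  show "l \<le> S / (real n - 1) + sqrt ((real n - 2) / (real n - 1) * (F - S\<^sup>2 / (real n - 1)))"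
    unfolding n1 n2 by (rule bound(1))
  have sum_const: "sum_list xs = k * b \<and> (\<Sum>x\<leftarrow>xs. x\<^sup>2) = k * b\<^sup>2" if "set xs \<subseteq> {b}" for b
    unfolding k_def using that by (induction xs) (auto simp: algebra_simps)
  show "l = S / (real n - 1) + sqrt ((real n - 2) / (real n - 1) * (F - S\<^sup>2 / (real n - 1)))
      \<longleftrightarrow> F = S\<^sup>2 / (real n - 1)
        \<or> (3 \<le> n \<and> card (spectrum A) = 3 \<and> spectrum A = {l, (S - l) / (real n - 2), 0})"
    (is "?E \<longleftrightarrow> ?scalar \<or> ?three")
  proof
    assume ?E
    then obtain b where b: "set xs \<subseteq> {b}" using bound(2) unfolding n1 n2 by blast
    show "?scalar \<or> ?three"
    proof (cases "xs = [] \<or> b = l")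
      case True
      hence "S = (k + 1) * l" "F = (k + 1) * l\<^sup>2"
        using sum_const[OF b] by (auto simp: S F k_def algebra_simps)
      thus ?thesis unfolding n1 using k by (simp add: power2_eq_square)
    next
      case False
      hence b': "set xs = {b}" using b by (metis set_empty subset_singletonD)
      hence "b \<noteq> 0" using xs0 by auto
      moreover have "0 < k" using False by (simp add: k_def)
      hence "b = (S - l) / k" using sum_const[OF b] by (simp add: S)
      moreover have "3 \<le> n" using False by (cases xs) (auto simp: n)
      ultimately show ?thesis using False l0 spec b' unfolding n2 by auto
    qed
  next
    assume "?scalar \<or> ?three"
    thus ?E
    proof
      assume ?scalar
      moreover have "S / (k + 1) \<le> l" using bound(3) k by (simp add: field_simps)
      ultimately show ?E using bound(1) unfolding n1 n2 by simp
    next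
      assume three: ?three
      define b where "b = (S - l) / k"
      from three have "3 \<le> n" and card: "card (spectrum A) = 3"
        and sp: "spectrum A = {l, b, 0}" unfolding n2 b_def by blast+
      have kpos: "0 < k" using \<open>3 \<le> n\<close> n unfolding k_def by linarith
      have "b \<noteq> l"
      proof
        assume "b = l"
        hence "card {l, b, 0} \<le> 2" by (simp add: card_insert_if)
        thus False using card unfolding sp by simp
      qed
      have "set xs \<subseteq> {l, b}" using sp spec xs0 by auto
      have "b \<le> l"
      proof -
        have "S - l \<le> k * l" using bound(3) by (simp add: algebra_simps)
        thus ?thesis unfolding b_def using kpos by (simp add: field_simps)
      qed
      \<comment> \<open>The deviations from \<open>b\<close> are nonnegative, being \<open>0\<close> or \<open>l - b\<close>, and sum to zero.\<close>
      have "(\<Sum>x\<leftarrow>xs. x - b) = sum_list xs - k * b"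
        unfolding k_def by (induction xs) (auto simp: algebra_simps)
      also have "\<dots> = 0" using kpos by (simp add: b_def S)
      finally have "\<forall>x\<in>set xs. x - b = 0"
        using \<open>set xs \<subseteq> {l, b}\<close> \<open>b \<le> l\<close> by (subst (asm) sum_list_nonneg_eq_0_iff) auto
      thus ?E using bound(2) unfolding n1 n2 by auto
    qed
  qed
qed

section \<open>Weighted Laplacians: kernel, and distance to the complete graph\<close>

text \<open>
  If \<open>A x = 0\<close>, then the nonnegative terms \<open>d\<^sub>i\<^sub>j (x\<^sub>i - x\<^sub>j)\<^sup>2\<close> sum to \<open>2 x\<^sup>T A x = 0\<close>, so each of them vanishes.
\<close>

lemma weighted_laplacian_kernel:
  fixes A :: "real mat" and d :: "nat \<Rightarrow> nat \<Rightarrow> real"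
  assumes A: "A \<in> carrier_mat n n"
    and A_def: "\<And>i j. i < n \<Longrightarrow> j < n \<Longrightarrow> A $$ (i, j) = (if i = j then \<Sum>k<n. d i k else 0) - d i j"
    and sym: "\<And>i j. i < n \<Longrightarrow> j < n \<Longrightarrow> d i j = d j i"
    and pos: "\<And>i j. i < n \<Longrightarrow> j < n \<Longrightarrow> i \<noteq> j \<Longrightarrow> 0 < d i j"
    and x: "x \<in> carrier_vec n" and ker: "A *\<^sub>v x = 0\<^sub>v n"
  shows "\<exists>c. x = c \<cdot>\<^sub>v vec n (\<lambda>_. 1)"
proof -
  have row: "(\<Sum>j<n. d i j * (x $ i - x $ j)) = 0" if i: "i < n" for i
  proof -
    have "0 = (\<Sum>j<n. A $$ (i, j) * x $ j)"
      using mat_vec_mult_index_sum[OF A x i] ker i by simp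
    also have "\<dots> = (\<Sum>j<n. (if i = j then (\<Sum>k<n. d i k) * x $ i else 0) - d i j * x $ j)"
      using i by (intro sum.cong) (auto simp: A_def left_diff_distrib)
    also have "\<dots> = (\<Sum>j<n. d i j * (x $ i - x $ j))"
      using i by (simp add: sum_subtractf right_diff_distrib sum_distrib_right)
    finally show ?thesis by simp
  qed
  have swap: "(\<Sum>i<n. \<Sum>j<n. d i j * (x $ i - x $ j) * x $ j)
      = - (\<Sum>i<n. \<Sum>j<n. d i j * (x $ i - x $ j) * x $ i)"
    by (subst sum.swap, unfold sum_negf[symmetric], intro sum.cong refl) (auto simp: sym algebra_simps)
  have "(\<Sum>i<n. \<Sum>j<n. d i j * (x $ i - x $ j)\<^sup>2)
      = (\<Sum>i<n. \<Sum>j<n. d i j * (x $ i - x $ j) * x $ i) - (\<Sum>i<n. \<Sum>j<n. d i j * (x $ i - x $ j) * x $ j)"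
    unfolding sum_subtractf[symmetric] by (intro sum.cong refl) (simp add: power2_eq_square algebra_simps)
  also have "\<dots> = 2 * (\<Sum>i<n. (\<Sum>j<n. d i j * (x $ i - x $ j)) * x $ i)"
    unfolding swap by (simp add: sum_distrib_right)
  also have "\<dots> = 0" by (simp add: row)
  finally have z: "(\<Sum>i<n. \<Sum>j<n. d i j * (x $ i - x $ j)\<^sup>2) = 0" .
  have nn: "0 \<le> d i j * (x $ i - x $ j)\<^sup>2" if "i < n" "j < n" for i j
    using pos[OF that] by (cases "i = j") auto
  have const: "x $ i = x $ j" if ij: "i < n" "j < n" for i j
  proof -
    have "(\<Sum>j<n. d i j * (x $ i - x $ j)\<^sup>2) = 0"
      using z ij nn by (subst (asm) sum_nonneg_eq_0_iff) (auto intro!: sum_nonneg)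
    hence "d i j * (x $ i - x $ j)\<^sup>2 = 0"
      using ij nn by (subst (asm) sum_nonneg_eq_0_iff) auto
    thus ?thesis using pos[OF ij] by (cases "i = j") auto
  qed
  have "x = x $ 0 \<cdot>\<^sub>v vec n (\<lambda>_. 1)"
  proof (rule eq_vecI)
    fix i assume "i < dim_vec (x $ 0 \<cdot>\<^sub>v vec n (\<lambda>_. 1))"
    hence "i < n" by simp
    thus "x $ i = (x $ 0 \<cdot>\<^sub>v vec n (\<lambda>_. 1)) $ i" using const[of i 0] by simp
  qed (use x in simp)
  thus ?thesis ..
qed

text \<open>
  The subtracted matrix \<open>c (n I - J)\<close> has the same trace as \<open>f\<close>.  Among the multiples of \<open>n I - J\<close> it is
  the one nearest to \<open>f\<close>, which is why the cross term merges into a single correction.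
\<close>

lemma frobenius_distance_to_complete:
  fixes f :: "nat \<Rightarrow> nat \<Rightarrow> real"
  assumes n: "2 \<le> n" and row: "(\<Sum>i<n. \<Sum>j<n. f i j) = 0"
  defines "S \<equiv> \<Sum>i<n. f i i"
  defines "c \<equiv> S / (real n * (real n - 1))"
  shows "(\<Sum>i<n. \<Sum>j<n. (f i j - c * (if i = j then real n - 1 else - 1))\<^sup>2)
    = (\<Sum>i<n. \<Sum>j<n. (f i j)\<^sup>2) - S\<^sup>2 / (real n - 1)"
proof -
  have delta: "(\<Sum>i<n. \<Sum>j<n. if i = j then g i else 0) = (\<Sum>i<n. g i)" for g :: "nat \<Rightarrow> real"
    by (intro sum.cong) (auto simp: sum.delta)
  have "(\<Sum>i<n. \<Sum>j<n. (f i j - c * (if i = j then real n - 1 else - 1))\<^sup>2)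
      = (\<Sum>i<n. \<Sum>j<n. (f i j)\<^sup>2 + 2 * c * f i j + c\<^sup>2
          + (if i = j then - 2 * c * real n * f i i + c\<^sup>2 * ((real n - 1)\<^sup>2 - 1) else 0))"
    by (intro sum.cong refl) (auto simp: power2_eq_square algebra_simps)
  also have "\<dots> = (\<Sum>i<n. \<Sum>j<n. (f i j)\<^sup>2) + 2 * c * (\<Sum>i<n. \<Sum>j<n. f i j) + real n * real n * c\<^sup>2
      + (- 2 * c * real n * S + real n * c\<^sup>2 * ((real n - 1)\<^sup>2 - 1))"
    unfolding sum.distrib delta by (simp add: S_def sum_distrib_left sum_negf)
  also have "\<dots> = (\<Sum>i<n. \<Sum>j<n. (f i j)\<^sup>2) - S\<^sup>2 / (real n - 1)"
  proof -
    have S: "S = c * (real n * (real n - 1))" using n by (simp add: c_def)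
    have "real n - 1 \<noteq> 0" using n by simp
    thus ?thesis unfolding row S by (simp add: field_simps power2_eq_square)
  qed
  finally show ?thesis .
qed

section \<open>Graph distance\<close>

text \<open>
  Reversing the vertex sequence as well shows that the reverse of a path is again a path.
\<close>

lemma (in sym_digraph) awalk_reverse:
  assumes "awalk u p v"
  shows "\<exists>q. awalk v q u \<and> length q = length p \<and> awalk_verts v q = rev (awalk_verts u p)"
  using assms
proof (induction p arbitrary: u)
  case Nil
  then show ?case by (intro exI[of _ "[]"]) (auto simp: awalk_Nil_iff)
next
  case (Cons e es)
  hence e: "e \<in> arcs G" "u = tail G e" and es: "awalk (head G e) es v"
    by (auto simp: awalk_Cons_iff)
  from Cons.IH[OF es] obtain q where q: "awalk v q (head G e)" "length q = length es"
    "awalk_verts v q = rev (awalk_verts (head G e) es)" by blast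
  have "(head G e, tail G e) \<in> arcs_ends G"
    by (rule arcs_ends_symmetric[OF sym_arcs]) (use e(1) in \<open>auto simp: arcs_ends_conv\<close>)
  then obtain e' where e': "e' \<in> arcs G" "tail G e' = head G e" "head G e' = tail G e"
    by (auto simp: arcs_ends_conv)
  have "awalk (head G e) [e'] u"
    using e e' by (auto simp: awalk_Cons_iff awalk_Nil_iff)
  hence "awalk v (q @ [e']) u" using q(1) by auto
  moreover have "awalk_verts v (q @ [e']) = awalk_verts v q @ [u]"
    using e e' awlast_if_cas[of v q "head G e"] q(1)
    by (auto simp: awalk_verts_conv split: if_splits)
  ultimately show ?case using q(2,3) e(2) by (intro exI[of _ "q @ [e']"]) auto
qed

context graph
begin

lemma shortest_apath:
  assumes "u \<rightarrow>\<^sup>* v"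
  obtains p where "apath u p v" "length p = graph_dist G u v"
proof -
  from assms have "\<exists>k p. apath u p v \<and> length p = k" by (simp add: reachable_apath)
  from LeastI_ex[OF this] that show ?thesis unfolding graph_dist_def by blast
qed

lemma graph_dist_le: "apath u p v \<Longrightarrow> graph_dist G u v \<le> length p"
  unfolding graph_dist_def by (rule Least_le) blast

lemma graph_dist_refl: "u \<in> verts G \<Longrightarrow> graph_dist G u u = 0"
  using graph_dist_le[of u "[]" u] by (simp add: apath_Nil_iff)

lemma graph_dist_sym: "graph_dist G u v = graph_dist G v u"
proof -
  have "(\<exists>p. apath v p u \<and> length p = k)" if "\<exists>p. apath u p v \<and> length p = k" for u v k
    using that awalk_reverse[of u _ v] unfolding apath_def by (metis distinct_rev)
  hence "(\<exists>p. apath u p v \<and> length p = k) = (\<exists>p. apath v p u \<and> length p = k)" for k by blast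
  thus ?thesis unfolding graph_dist_def by simp
qed

lemma graph_dist_pos:
  assumes "u \<rightarrow>\<^sup>* v" "u \<noteq> v"
  shows "0 < graph_dist G u v"
proof -
  obtain p where p: "apath u p v" "length p = graph_dist G u v"
    using shortest_apath[OF assms(1)] .
  with assms(2) have "p \<noteq> []" by (auto simp: apath_Nil_iff)
  with p(2) show ?thesis by (cases p) auto
qed

lemma graph_dist_eq_1_iff:
  assumes "u \<rightarrow>\<^sup>* v" "u \<noteq> v"
  shows "graph_dist G u v = 1 \<longleftrightarrow> u \<rightarrow> v"
proof
  assume 1: "graph_dist G u v = 1"
  obtain p where "apath u p v" "length p = graph_dist G u v"
    using shortest_apath[OF assms(1)] .
  with 1 obtain e where "apath u [e] v" by (cases p) auto
  thus "u \<rightarrow> v" by (auto simp: apath_Cons_iff apath_Nil_iff arcs_ends_conv)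
next
  assume "u \<rightarrow> v"
  then obtain e where "e \<in> arcs G" "tail G e = u" "head G e = v" by (auto simp: arcs_ends_conv)
  hence "apath u [e] v" using assms(2) by (auto simp: apath_Cons_iff apath_Nil_iff)
  from graph_dist_le[OF this] graph_dist_pos[OF assms] show "graph_dist G u v = 1" by simp
qed

lemma connected_reachable:
  assumes "connected G" "u \<in> verts G" "v \<in> verts G"
  shows "u \<rightarrow>\<^sup>* v"
  using symmetric_connected_imp_strongly_connected[OF sym_arcs assms(1)] assms(2,3) by auto

lemma complete_digraph_iff_dist:
  assumes "connected G"
  shows "complete_digraph n G \<longleftrightarrow> card (verts G) = n
    \<and> (\<forall>u\<in>verts G. \<forall>v\<in>verts G. u \<noteq> v \<longrightarrow> graph_dist G u v = 1)"
proof -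
  have "arcs_ends G = {(u, v). (u, v) \<in> verts G \<times> verts G \<and> u \<noteq> v}
      \<longleftrightarrow> (\<forall>u\<in>verts G. \<forall>v\<in>verts G. u \<noteq> v \<longrightarrow> u \<rightarrow> v)"
    by (auto dest: adj_in_verts adj_not_same)
  thus ?thesis
    unfolding complete_digraph_def using graph_axioms graph_dist_eq_1_iff[OF connected_reachable[OF assms]] by auto
qed

text \<open>
  A connected graph with two vertices has an arc, and the ends of an arc have distance 1.
\<close>

lemma constant_dist_eq_1:
  assumes conn: "connected G" and uv: "u \<in> verts G" "v \<in> verts G" "u \<noteq> v"
    and const: "\<And>x y. x \<in> verts G \<Longrightarrow> y \<in> verts G \<Longrightarrow> x \<noteq> y \<Longrightarrow> real (graph_dist G x y) = c"
  shows "c = 1"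
proof -
  from connected_reachable[OF conn uv(1,2)] uv(3) obtain w where w: "u \<rightarrow> w"
    by (cases rule: converse_reachable_cases) auto
  hence w': "w \<in> verts G" "u \<noteq> w" using adj_in_verts(2) adj_not_same by auto
  have "graph_dist G u w = 1"
    using graph_dist_eq_1_iff[OF connected_reachable[OF conn uv(1) w'(1)] w'(2)] w by blast
  with const[OF uv(1) w'] show ?thesis by simp
qed

end

section \<open>The distance Laplacian of an enumerated graph\<close>

locale enumerated_connected_graph = graph G
  for G :: "('a, 'b) pre_digraph" +
  fixes vs :: "'a list" and n :: nat
  assumes conn: "connected G"
    and vs_distinct: "distinct vs" and vs_verts: "set vs = verts G"
    and card_verts: "card (verts G) = n" and n_ge_2: "2 \<le> n"
begin

definition d :: "nat \<Rightarrow> nat \<Rightarrow> real" where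
  "d i j = real (graph_dist G (vs ! i) (vs ! j))"

abbreviation "L \<equiv> distance_laplacian G vs"

lemma length_vs: "length vs = n"
  using distinct_card[OF vs_distinct] vs_verts card_verts by simp

lemma bij_nth: "bij_betw ((!) vs) {..<n} (verts G)"
  using bij_betw_nth[OF vs_distinct, of "{..<n}" "verts G"] vs_verts length_vs by simp

lemma nth_verts: "i < n \<Longrightarrow> vs ! i \<in> verts G"
  using nth_mem[of i vs] length_vs vs_verts by simp

lemma nth_neq: "i < n \<Longrightarrow> j < n \<Longrightarrow> i \<noteq> j \<Longrightarrow> vs ! i \<noteq> vs ! j"
  using vs_distinct length_vs by (simp add: nth_eq_iff_index_eq)

lemma vert_index:
  assumes "u \<in> verts G"
  obtains i where "i < n" "u = vs ! i"
  using assms bij_nth unfolding bij_betw_def by blast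

lemma d_sym: "d i j = d j i"
  unfolding d_def by (simp only: graph_dist_sym[of "vs ! i" "vs ! j"])

lemma d_diag: "i < n \<Longrightarrow> d i i = 0"
  using graph_dist_refl[OF nth_verts] by (simp add: d_def)

lemma d_pos: "i < n \<Longrightarrow> j < n \<Longrightarrow> i \<noteq> j \<Longrightarrow> 0 < d i j"
  using graph_dist_pos[OF connected_reachable[OF conn nth_verts nth_verts] nth_neq, of i j]
  by (simp add: d_def)

lemma d_nonneg: "0 \<le> d i j"
  by (simp add: d_def)

lemma transmission_eq: "transmission G (vs ! i) = (\<Sum>j<n. d i j)"
  unfolding transmission_def d_def by (rule sum.reindex_bij_betw[OF bij_nth, symmetric])

lemma wiener_eq: "2 * wiener_index G = (\<Sum>i<n. \<Sum>j<n. d i j)"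
proof -
  have "2 * wiener_index G = (\<Sum>u\<in>verts G. transmission G u)"
    by (simp add: wiener_index_def transmission_def)
  also have "\<dots> = (\<Sum>i<n. transmission G (vs ! i))"
    by (rule sum.reindex_bij_betw[OF bij_nth, symmetric])
  finally show ?thesis by (simp only: transmission_eq)
qed

lemma wiener_pos: "0 < 2 * wiener_index G"
proof -
  have "0 < d 0 1" using d_pos[of 0 1] n_ge_2 by simp
  also have "\<dots> \<le> (\<Sum>j<n. d 0 j)"
    using n_ge_2 d_nonneg by (intro member_le_sum) auto
  also have "\<dots> \<le> (\<Sum>i<n. \<Sum>j<n. d i j)"
    using n_ge_2 d_nonneg
    by (intro member_le_sum[of 0 _ "\<lambda>i. \<Sum>j<n. d i j"]) (auto intro: sum_nonneg)
  finally show ?thesis by (simp only: wiener_eq)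
qed

lemma L_carrier: "L \<in> carrier_mat n n"
  unfolding distance_laplacian_def distance_matrix_def length_vs
  by (rule minus_carrier_mat) simp

lemma L_entry:
  "i < n \<Longrightarrow> j < n \<Longrightarrow> L $$ (i, j) = (if i = j then \<Sum>k<n. d i k else 0) - d i j"
  unfolding distance_laplacian_def distance_matrix_def transmission_matrix_def
  by (simp add: length_vs mat_diag_def transmission_eq d_def)

lemma L_sym: "i < n \<Longrightarrow> j < n \<Longrightarrow> L $$ (i, j) = L $$ (j, i)"
  using d_sym[of i j] by (simp add: L_entry)

lemma L_row_sum: "i < n \<Longrightarrow> (\<Sum>j<n. L $$ (i, j)) = 0"
  by (simp add: L_entry sum_subtractf)

lemma L_trace: "mat_trace L = 2 * wiener_index G"
  using L_carrier unfolding mat_trace_def wiener_eq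
  by (auto simp: L_entry d_diag intro!: sum.cong)

lemma L_ones: "L *\<^sub>v vec n (\<lambda>_. 1) = 0\<^sub>v n"
proof (rule eq_vecI)
  fix i assume "i < dim_vec (0\<^sub>v n :: real vec)"
  hence i: "i < n" by simp
  thus "(L *\<^sub>v vec n (\<lambda>_. 1)) $ i = 0\<^sub>v n $ i"
    using mat_vec_mult_index_sum[OF L_carrier _ i, of "vec n (\<lambda>_. 1)"] L_row_sum[OF i] by simp
qed (use L_carrier in simp)

lemma ones_nonzero: "vec n (\<lambda>_. 1 :: real) \<noteq> 0\<^sub>v n"
proof
  assume "vec n (\<lambda>_. 1 :: real) = 0\<^sub>v n"
  hence "vec n (\<lambda>_. 1 :: real) $ 0 = 0\<^sub>v n $ 0" by simp
  thus False using n_ge_2 by simp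
qed

lemma L_kernel: "x \<in> carrier_vec n \<Longrightarrow> L *\<^sub>v x = 0\<^sub>v n \<Longrightarrow> \<exists>c. x = c \<cdot>\<^sub>v vec n (\<lambda>_. 1)"
  by (rule weighted_laplacian_kernel[OF L_carrier L_entry d_sym d_pos])

text \<open>
  Vanishing distance to \<open>c (n I - J)\<close> means that all off-diagonal distances equal \<open>c\<close>, and then \<open>c = 1\<close>.
\<close>

lemma frobenius_eq_iff_complete:
  "(frobenius_norm L)\<^sup>2 = (2 * wiener_index G)\<^sup>2 / (real n - 1) \<longleftrightarrow> complete_digraph n G"
proof -
  define c where "c = 2 * wiener_index G / (real n * (real n - 1))"
  define D where "D i j = L $$ (i, j) - c * (if i = j then real n - 1 else - 1)" for i j
  have tr: "(\<Sum>i<n. L $$ (i, i)) = 2 * wiener_index G"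
    using L_carrier L_trace by (simp add: mat_trace_def)
  have D: "(\<Sum>i<n. \<Sum>j<n. (D i j)\<^sup>2)
      = (frobenius_norm L)\<^sup>2 - (2 * wiener_index G)\<^sup>2 / (real n - 1)"
    using frobenius_distance_to_complete[OF n_ge_2, of "\<lambda>i j. L $$ (i, j)"] L_row_sum
    unfolding frobenius_norm_sum[OF L_carrier] c_def D_def tr by simp
  have D_zero: "(\<Sum>i<n. \<Sum>j<n. (D i j)\<^sup>2) = 0 \<longleftrightarrow> (\<forall>i<n. \<forall>j<n. D i j = 0)"
    by (auto simp: sum_nonneg_eq_0_iff sum_nonneg)
  have "(\<forall>i<n. \<forall>j<n. D i j = 0) \<longleftrightarrow> complete_digraph n G"
  proof
    assume z: "\<forall>i<n. \<forall>j<n. D i j = 0"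
    have dist: "real (graph_dist G u v) = c" if uv: "u \<in> verts G" "v \<in> verts G" "u \<noteq> v" for u v
    proof -
      obtain i j where ij: "i < n" "u = vs ! i" "j < n" "v = vs ! j"
        using vert_index[OF uv(1)] vert_index[OF uv(2)] by metis
      with uv(3) have "i \<noteq> j" by auto
      moreover have "D i j = 0" using z ij by blast
      ultimately have "d i j = c" using ij(1,3) by (simp add: D_def L_entry)
      thus ?thesis by (simp add: d_def ij)
    qed
    have "c = 1"
      by (rule constant_dist_eq_1[OF conn nth_verts[of 0] nth_verts[of 1] nth_neq dist])
        (use n_ge_2 in auto)
    with dist show "complete_digraph n G"
      unfolding complete_digraph_iff_dist[OF conn] using card_verts by simp
  next
    assume "complete_digraph n G"
    hence "graph_dist G u v = 1" if "u \<in> verts G" "v \<in> verts G" "u \<noteq> v" for u v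
      using that unfolding complete_digraph_iff_dist[OF conn] by blast
    hence d1: "d i j = (if i = j then 0 else 1)" if "i < n" "j < n" for i j
      using that d_diag nth_verts nth_neq by (auto simp: d_def)
    have row: "(\<Sum>k<n. d i k) = real n - 1" if i: "i < n" for i
    proof -
      have "(\<Sum>k<n. d i k) = (\<Sum>k<n. 1 - (if i = k then 1 else 0))"
        using i by (intro sum.cong) (auto simp: d1)
      thus ?thesis using i by (simp add: sum_subtractf)
    qed
    have "c = 1" using row n_ge_2 by (simp add: c_def wiener_eq)
    moreover have "L $$ (i, j) = (if i = j then real n - 1 else - 1)" if ij: "i < n" "j < n" for i j
      using row[OF ij(1)] row[OF ij(2)] d1[OF ij] by (simp add: L_entry[OF ij])
    ultimately show "\<forall>i<n. \<forall>j<n. D i j = 0" by (simp add: D_def)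
  qed
  thus ?thesis using D_zero D by simp
qed

end

section \<open>The bound for the distance Laplacian\<close>

theorem theorem11:
  fixes G :: "('a, 'b) pre_digraph" and vs :: "'a list" and n :: nat
  assumes "graph G"
    and "Digraph_Component.connected G"
    and "distinct vs" and "set vs = verts G"
    and "card (verts G) = n" and "n \<ge> 2"
  shows "dist_lap_eigenvalue G vs 1
           \<le> 2 * wiener_index G / (real n - 1)
             + sqrt ((real n - 2) / (real n - 1)
                 * ((frobenius_norm (distance_laplacian G vs))\<^sup>2
                    - (2 * wiener_index G)\<^sup>2 / (real n - 1)))
         \<and> (dist_lap_eigenvalue G vs 1
              = 2 * wiener_index G / (real n - 1)
                + sqrt ((real n - 2) / (real n - 1)
                    * ((frobenius_norm (distance_laplacian G vs))\<^sup>2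
                       - (2 * wiener_index G)\<^sup>2 / (real n - 1)))
            \<longleftrightarrow> complete_digraph n G
                \<or> (n \<ge> 3
                   \<and> card (spectrum (distance_laplacian G vs)) = 3
                   \<and> spectrum (distance_laplacian G vs)
                       = {dist_lap_eigenvalue G vs 1,
                          (2 * wiener_index G - dist_lap_eigenvalue G vs 1) / (real n - 2),
                          0}))"
proof -
  interpret graph G by fact
  interpret enumerated_connected_graph G vs n
    by unfold_locales (use assms in simp_all)
  have first: "dist_lap_eigenvalue G vs 1 = eigenvalues_desc (distance_laplacian G vs) ! 0"
    by (simp add: dist_lap_eigenvalue_def)
  show ?thesis
    unfolding first frobenius_eq_iff_complete[symmetric] L_trace[symmetric]
    by (intro conjI
        largest_eigenvalue_bound[OF L_carrier L_sym L_kernel vec_carrier ones_nonzero L_ones])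
      (simp_all only: L_trace wiener_pos)
qed

end
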